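(* The equation $13\cdot 3^x+13^y=z^2$ has no solutions $(x,y,z)\in\mathbb{N}^3$.
   Context: $\mathbb{N}=\{0,1,2,3,\ldots\}$ denotes the set of non-negative integers. *)

theory Defs imports Main
begin

end

theory Submission imports Defs "HOL-Computational_Algebra.Primes" begin

text \<open>
  If \<open>y > 0\<close>, then 13 divides \<open>z\<close>, hence also \<open>3 ^ x + 13 ^ (y - 1)\<close>; this is impossible because the
  powers of 3 are 1, 3, 9 modulo 13. If \<open>y = 0\<close>, then \<open>13 * 3 ^ x = (z - 1) * (z + 1)\<close>, and 3 cannot
  divide both factors. So \<open>3 ^ x\<close> divides one of them, and the remaining cofactor divides 13, which
  would make 11 or 15 a power of 3.
\<close>

text \<open>Since 27 is 1 modulo 13, multiplication by 3 permutes these residues.\<close>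

lemma three_power_mod_13: "(3::nat) ^ x mod 13 \<in> {1, 3, 9}"
proof (induction x)
  case (Suc x)
  have "3 ^ Suc x mod 13 = 3 * (3 ^ x mod 13) mod (13::nat)"
    by (simp add: mod_mult_right_eq)
  with Suc show ?case
    by auto
qed simp

lemma no_solution_pos_exponent:
  fixes x y z :: nat
  shows "13 * 3 ^ x + 13 ^ Suc y \<noteq> z\<^sup>2"
proof
  assume eq: "13 * 3 ^ x + 13 ^ Suc y = z\<^sup>2"
  have "13 dvd z\<^sup>2"
    unfolding eq[symmetric] by (intro dvd_add) simp_all
  moreover have "prime (13::nat)"
    by simp
  ultimately have "13 dvd z"
    by (rule prime_dvd_power_nat[rotated])
  then obtain w where "z = 13 * w" ..
  with eq have "3 ^ x + 13 ^ y = 13 * w\<^sup>2"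
    by (simp add: power2_eq_square)
  then have "(3 ^ x mod 13 + 13 ^ y mod 13) mod 13 = (0::nat)"
    by (simp add: mod_add_eq)
  \<comment> \<open>Modulo 13, \<open>13 ^ y\<close> is 1 for \<open>y = 0\<close> and 0 otherwise,
    so the sum is one of 2, 4, 10 or one of 1, 3, 9.\<close>
  then show False
    using three_power_mod_13[of x] by (cases y) (auto dest: dvd_imp_le)
qed

text \<open>A factor not divisible by \<open>p\<close> is coprime to \<open>p ^ n\<close>, so the
  whole power divides the other factor.\<close>

lemma prime_power_dvd_mult_cases:
  fixes p a b :: nat
  assumes "prime p" and "p ^ n dvd a * b" and "\<not> (p dvd a \<and> p dvd b)"
  shows "p ^ n dvd a \<or> p ^ n dvd b"
proof (cases "p dvd a")
  case True
  with assms have "coprime (p ^ n) b"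
    by (simp add: prime_imp_coprime)
  with assms(2) show ?thesis
    by (simp add: coprime_dvd_mult_left_iff)
next
  case False
  with assms have "coprime (p ^ n) a"
    by (simp add: prime_imp_coprime)
  with assms(2) show ?thesis
    by (simp add: coprime_dvd_mult_right_iff)
qed

lemma dvd_13_cases:
  fixes k :: nat
  assumes "k dvd 13"
  shows "k = 1 \<or> k = 13"
proof -
  have "prime (13::nat)"
    by simp
  with assms show ?thesis
    by (simp add: prime_nat_iff)
qed

lemma no_solution_zero_exponent:
  fixes x z :: nat
  shows "13 * 3 ^ x + 1 \<noteq> z\<^sup>2"
proof
  assume eq: "13 * 3 ^ x + 1 = z\<^sup>2"
  \<comment> \<open>Here \<open>u\<close> is \<open>z - 1\<close>; the factors become
    \<open>u\<close> and \<open>u + 2\<close>, without truncated subtraction.\<close>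
  then obtain u where z: "z = Suc u"
    by (cases z) auto
  with eq have prod: "u * (u + 2) = 3 ^ x * 13"
    by (simp add: power2_eq_square)
  \<comment> \<open>A common divisor would divide the difference 2.\<close>
  have "\<not> (3 dvd u \<and> 3 dvd u + 2)"
    by presburger
  moreover have "3 ^ x dvd u * (u + 2)"
    unfolding prod by simp
  ultimately consider "3 ^ x dvd u" | "3 ^ x dvd u + 2"
    using prime_power_dvd_mult_cases[of 3 x u "u + 2"] by auto
  then show False
  proof cases
    case 1
    then obtain k where k: "u = 3 ^ x * k" ..
    then have "3 ^ x * (k * (u + 2)) = 3 ^ x * 13"
      using prod by (metis mult.assoc)
    then have k13: "k * (u + 2) = 13"
      by simp
    then have "k = 1 \<or> k = 13"
      by (metis dvd_13_cases dvd_triv_left)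
    \<comment> \<open>\<open>k = 1\<close> gives \<open>u = 11\<close>, while \<open>k = 13\<close>
      would force \<open>u + 2 = 1\<close>.\<close>
    then have "3 ^ x = (11::nat)"
      using k k13 by auto
    then show False
      using three_power_mod_13[of x] by simp
  next
    case 2
    then obtain k where k: "u + 2 = 3 ^ x * k" ..
    then have "3 ^ x * (k * u) = 3 ^ x * 13"
      using prod by (metis mult.assoc mult.commute)
    then have k13: "k * u = 13"
      by simp
    then have "k = 1 \<or> k = 13"
      by (metis dvd_13_cases dvd_triv_left)
    then show False
    proof
      assume "k = 1"
      with k k13 have "3 ^ x = (15::nat)"
        by simp
      then show False
        using three_power_mod_13[of x] by simp
    next
      assume "k = 13"
      \<comment> \<open>Now \<open>u = 1\<close>, so \<open>u + 2 = 3\<close> would be a multiple of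
        13.\<close>
      with k k13 have "13 * 3 ^ x = (3::nat)"
        by simp
      then show False
        by presburger
    qed
  qed
qed

theorem theorem0p17:
  "\<not> (\<exists>x y z :: nat. 13 * 3 ^ x + 13 ^ y = z ^ 2)"
proof clarify
  fix x y z :: nat
  assume "13 * 3 ^ x + 13 ^ y = z\<^sup>2"
  then show False
    using no_solution_zero_exponent[of x z] no_solution_pos_exponent[of x _ z]
    by (cases y) auto
qed

end
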